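(* There exist perfect skew braces $A=(A,\cdot,\circ)$ for which $\mathrm{Ann}(A/\mathrm{Ann}(A))\neq 1$.
   Context: A skew brace is a set $A=(A,\cdot,\circ)$ with two group operations $\cdot$ and $\circ$ such that $a\circ(b\cdot c)=(a\circ b)\cdot a^{-1}\cdot(a\circ c)$ for all $a,b,c\in A$, where $a^{-1}$ is the inverse of $a$ in $(A,\cdot)$. The two groups share the same identity element, denoted $1$; the trivial subgroup $\{1\}$ is also written $1$. For $a,b\in A$ put $a*b=a^{-1}\cdot(a\circ b)\cdot b^{-1}$; for subsets $X,Y\subseteq A$, $X*Y$ is the subgroup of $(A,\cdot)$ generated by all $x*y$ with $x\in X$, $y\in Y$. The skew brace $A$ is perfect if $A=A*A$. An ideal of $A$ is a subset $I$ that is a normal subgroup of both $(A,\cdot)$ and $(A,\circ)$ with $a\cdot I=a\circ I$ for all $a\in A$; then the coset space $A/I$ is naturally a (quotient) skew brace. The annihilator of $A$ is the ideal $\mathrm{Ann}(A)=\{a\in A\mid \forall x\in A:\ a*x=1=x*a\}\cap Z(A,\cdot)$, where $Z$ denotes the center of a group. *)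

theory Defs
  imports "HOL-Algebra.Coset" "HOL-Algebra.Generated_Groups"
begin

text \<open>
  As a monoid record, a skew brace \<open>A\<close> stands for its group \<open>(A,\<cdot>)\<close>, so that the HOL-Algebra
  operations apply to it directly; \<open>circ_group A\<close> is the group \<open>(A,\<circ>)\<close>. Both groups use the field
  \<open>one\<close>: this loses no generality, since the compatibility law with \<open>b = c = 1\<close> forces
  their identities to agree.
\<close>

record 'a skew_brace = "'a monoid" +
  circ :: "'a \<Rightarrow> 'a \<Rightarrow> 'a"  (infixl \<open>\<odot>\<index>\<close> 70)

definition circ_group :: "('a, 'm) skew_brace_scheme \<Rightarrow> 'a monoid" where
  "circ_group A = \<lparr>carrier = carrier A, mult = circ A, one = one A\<rparr>"

locale skew_brace = group A + circ: group "circ_group A" for A (structure) +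
  assumes compat: "\<lbrakk>a \<in> carrier A; b \<in> carrier A; c \<in> carrier A\<rbrakk>
    \<Longrightarrow> a \<odot> (b \<otimes> c) = (a \<odot> b) \<otimes> inv a \<otimes> (a \<odot> c)"

definition brace_star :: "('a, 'm) skew_brace_scheme \<Rightarrow> 'a \<Rightarrow> 'a \<Rightarrow> 'a" where
  "brace_star A a b = inv\<^bsub>A\<^esub> a \<otimes>\<^bsub>A\<^esub> (a \<odot>\<^bsub>A\<^esub> b) \<otimes>\<^bsub>A\<^esub> inv\<^bsub>A\<^esub> b"

definition brace_star_set :: "('a, 'm) skew_brace_scheme \<Rightarrow> 'a set \<Rightarrow> 'a set \<Rightarrow> 'a set" where
  "brace_star_set A X Y = generate A {brace_star A x y | x y. x \<in> X \<and> y \<in> Y}"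

definition perfect :: "('a, 'm) skew_brace_scheme \<Rightarrow> bool" where
  "perfect A \<longleftrightarrow> carrier A = brace_star_set A (carrier A) (carrier A)"

definition group_center :: "('a, 'm) monoid_scheme \<Rightarrow> 'a set" where
  "group_center G = {z \<in> carrier G. \<forall>x \<in> carrier G. z \<otimes>\<^bsub>G\<^esub> x = x \<otimes>\<^bsub>G\<^esub> z}"

definition Ann :: "('a, 'm) skew_brace_scheme \<Rightarrow> 'a set" where
  "Ann A = {a \<in> carrier A. \<forall>x \<in> carrier A. brace_star A a x = \<one>\<^bsub>A\<^esub> \<and> brace_star A x a = \<one>\<^bsub>A\<^esub>}
             \<inter> group_center A"

definition brace_ideal :: "'a set \<Rightarrow> ('a, 'm) skew_brace_scheme \<Rightarrow> bool" where
  "brace_ideal I A \<longleftrightarrow> I \<lhd> A \<and> I \<lhd> circ_group A \<and>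
     (\<forall>a \<in> carrier A. a <#\<^bsub>A\<^esub> I = a <#\<^bsub>circ_group A\<^esub> I)"

text \<open>
  For an ideal \<open>I\<close> the quotient groups \<open>A Mod I\<close> and \<open>circ_group A Mod I\<close> have the same carrier
  and identity; see \<open>circ_group_brace_quotient\<close> and \<open>skew_brace_quotient\<close> below.
\<close>

definition brace_quotient :: "('a, 'm) skew_brace_scheme \<Rightarrow> 'a set \<Rightarrow> 'a set skew_brace" where
  "brace_quotient A I =
     \<lparr>carrier = carrier (A Mod I), mult = mult (A Mod I), one = one (A Mod I),
      circ = mult (circ_group A Mod I)\<rparr>"

lemma circ_group_simps [simp]:
  "carrier (circ_group A) = carrier A"
  "mult (circ_group A) = circ A"
  "one (circ_group A) = one A"
  by (simp_all add: circ_group_def)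

context skew_brace
begin

lemma circ_closed [simp]: "\<lbrakk>a \<in> carrier A; b \<in> carrier A\<rbrakk> \<Longrightarrow> a \<odot> b \<in> carrier A"
  using circ.m_closed by simp

lemma brace_star_eq_one_iff:
  assumes "a \<in> carrier A" "b \<in> carrier A"
  shows "brace_star A a b = \<one> \<longleftrightarrow> a \<odot> b = a \<otimes> b"
proof -
  have "brace_star A a b = \<one> \<longleftrightarrow> inv a \<otimes> (a \<odot> b) = b"
    unfolding brace_star_def using assms
    by (metis circ_closed inv_closed inv_inv inv_equality m_closed r_inv)
  also have "\<dots> \<longleftrightarrow> a \<odot> b = a \<otimes> b"
    using assms by (metis circ_closed inv_solve_left)
  finally show ?thesis .
qed

lemma Ann_iff:
  "a \<in> Ann A \<longleftrightarrow> a \<in> carrier A \<and>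
     (\<forall>x \<in> carrier A. a \<odot> x = a \<otimes> x \<and> x \<odot> a = a \<otimes> x \<and> x \<otimes> a = a \<otimes> x)"
proof -
  have "a \<in> Ann A \<longleftrightarrow> a \<in> carrier A \<and>
     (\<forall>x \<in> carrier A. a \<odot> x = a \<otimes> x \<and> x \<odot> a = x \<otimes> a \<and> a \<otimes> x = x \<otimes> a)"
    unfolding Ann_def group_center_def Int_iff mem_Collect_eq
    using brace_star_eq_one_iff by blast
  then show ?thesis by metis
qed

lemma AnnD:
  assumes "a \<in> Ann A" "x \<in> carrier A"
  shows "a \<odot> x = a \<otimes> x" "x \<odot> a = a \<otimes> x" "x \<otimes> a = a \<otimes> x"
  using assms Ann_iff by blast+

lemma Ann_inv:
  assumes a: "a \<in> Ann A"
  shows "inv a \<in> Ann A" "inv\<^bsub>circ_group A\<^esub> a = inv a"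
proof -
  have ac: "a \<in> carrier A" and a1: "\<And>x. x \<in> carrier A \<Longrightarrow> a \<odot> x = a \<otimes> x"
    and a2: "\<And>x. x \<in> carrier A \<Longrightarrow> x \<odot> a = a \<otimes> x"
    and a3: "\<And>x. x \<in> carrier A \<Longrightarrow> x \<otimes> a = a \<otimes> x"
    using iffD1[OF Ann_iff a] by blast+
  have l_inv_circ: "inv a \<odot> a = \<one>" using a2[of "inv a"] ac by simp
  then show "inv\<^bsub>circ_group A\<^esub> a = inv a"
    using circ.inv_equality[of "inv a" a] ac by simp
  have c: "x \<otimes> inv a = inv a \<otimes> x" if "x \<in> carrier A" for x
  proof -
    have "inv a \<otimes> x = inv a \<otimes> ((x \<otimes> a) \<otimes> inv a)" using ac that by (simp add: m_assoc)
    also have "\<dots> = (inv a \<otimes> a) \<otimes> (x \<otimes> inv a)"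
      using ac that by (simp only: a3[OF that] m_assoc m_closed inv_closed)
    finally show ?thesis using ac that by simp
  qed
  have l: "inv a \<odot> x = inv a \<otimes> x" if x: "x \<in> carrier A" for x
  proof -
    have "a \<odot> (inv a \<otimes> x) = x"
      using a1[of "inv a \<otimes> x"] ac x by (simp add: m_assoc[symmetric])
    then show ?thesis
      using circ.m_assoc[of "inv a" a "inv a \<otimes> x"] circ.l_one[of "inv a \<otimes> x"] ac x l_inv_circ
      by simp
  qed
  have r: "x \<odot> inv a = inv a \<otimes> x" if x: "x \<in> carrier A" for x
  proof -
    have "x = x \<odot> (inv a \<otimes> a)" using ac x circ.r_one[of x] by simp
    also have "\<dots> = (x \<odot> inv a) \<otimes> (inv x \<otimes> (x \<otimes> a))"
      using compat[of x "inv a" a] ac x a2[OF x] a3[OF x] by (simp add: m_assoc)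
    also have "\<dots> = (x \<odot> inv a) \<otimes> a" using ac x by (simp add: m_assoc[symmetric])
    finally have "x \<odot> inv a = x \<otimes> inv a"
      using ac x by (metis circ_closed inv_closed inv_solve_right)
    then show ?thesis using c[OF x] by simp
  qed
  show "inv a \<in> Ann A" unfolding Ann_iff by (intro conjI ballI inv_closed ac c l r)
qed

lemma Ann_mult:
  assumes "a \<in> Ann A" "b \<in> Ann A"
  shows "a \<otimes> b \<in> Ann A"
proof -
  have ac: "a \<in> carrier A" and a1: "\<And>x. x \<in> carrier A \<Longrightarrow> a \<odot> x = a \<otimes> x"
    and a2: "\<And>x. x \<in> carrier A \<Longrightarrow> x \<odot> a = a \<otimes> x"
    and a3: "\<And>x. x \<in> carrier A \<Longrightarrow> x \<otimes> a = a \<otimes> x"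
    using iffD1[OF Ann_iff assms(1)] by blast+
  have bc: "b \<in> carrier A" and b1: "\<And>x. x \<in> carrier A \<Longrightarrow> b \<odot> x = b \<otimes> x"
    and b2: "\<And>x. x \<in> carrier A \<Longrightarrow> x \<odot> b = b \<otimes> x"
    and b3: "\<And>x. x \<in> carrier A \<Longrightarrow> x \<otimes> b = b \<otimes> x"
    using iffD1[OF Ann_iff assms(2)] by blast+
  have c: "x \<otimes> (a \<otimes> b) = (a \<otimes> b) \<otimes> x" if x: "x \<in> carrier A" for x
    using a3[OF x] b3[OF x] ac bc x by (metis m_assoc)
  have l: "(a \<otimes> b) \<odot> x = (a \<otimes> b) \<otimes> x" if x: "x \<in> carrier A" for x
    using circ.m_assoc[of a b x] a1 b1 ac bc x by (simp add: m_assoc)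
  have r: "x \<odot> (a \<otimes> b) = (a \<otimes> b) \<otimes> x" if x: "x \<in> carrier A" for x
  proof -
    have "x \<odot> (a \<otimes> b) = (x \<otimes> a) \<otimes> inv x \<otimes> (x \<otimes> b)"
      using compat[of x a b] a2[OF x] b2[OF x] a3[OF x] b3[OF x] ac bc x by simp
    also have "\<dots> = x \<otimes> a \<otimes> (inv x \<otimes> x \<otimes> b)"
      using ac bc x by (simp only: m_assoc m_closed inv_closed)
    finally have "x \<odot> (a \<otimes> b) = x \<otimes> (a \<otimes> b)" using ac bc x by (simp add: m_assoc)
    then show ?thesis using c[OF x] by (rule trans)
  qed
  show ?thesis unfolding Ann_iff by (intro conjI ballI m_closed ac bc c l r)
qed

lemma brace_ideal_Ann: "brace_ideal (Ann A) A"
proof -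
  have sub: "Ann A \<subseteq> carrier A" unfolding Ann_def by auto
  have one: "\<one> \<in> Ann A"
    unfolding Ann_iff using circ.l_one circ.r_one by auto
  have "subgroup (Ann A) A"
    using sub one Ann_inv Ann_mult by unfold_locales auto
  moreover have "Ann A #> x = x <# Ann A" if "x \<in> carrier A" for x
    using AnnD(3)[OF _ that] unfolding r_coset_def l_coset_def by simp
  ultimately have 1: "Ann A \<lhd> A"
    by (simp add: normal_def normal_axioms_def is_group)
  have "a \<odot> b = a \<otimes> b" if "a \<in> Ann A" "b \<in> Ann A" for a b
    using that sub AnnD(1) by blast
  then have "subgroup (Ann A) (circ_group A)"
    using sub one Ann_inv Ann_mult by unfold_locales auto
  moreover have "Ann A #>\<^bsub>circ_group A\<^esub> x = x <#\<^bsub>circ_group A\<^esub> Ann A"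
    if "x \<in> carrier A" for x
    using AnnD(1,2)[OF _ that] unfolding r_coset_def l_coset_def by simp
  ultimately have 2: "Ann A \<lhd> circ_group A"
    by (simp add: normal_def normal_axioms_def circ.is_group)
  have "x <# Ann A = x <#\<^bsub>circ_group A\<^esub> Ann A" if "x \<in> carrier A" for x
    using AnnD(2,3)[OF _ that] unfolding l_coset_def by simp
  with 1 2 show ?thesis unfolding brace_ideal_def by blast
qed

lemma brace_ideal_coset_eq:
  assumes "brace_ideal I A" "a \<in> carrier A"
  shows "I #>\<^bsub>circ_group A\<^esub> a = I #> a"
  using assms normal.coset_eq[of I A] normal.coset_eq[of I "circ_group A"]
  unfolding brace_ideal_def by simp

lemma circ_group_brace_quotient:
  assumes "brace_ideal I A"
  shows "circ_group (brace_quotient A I) = circ_group A Mod I"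
  using brace_ideal_coset_eq[OF assms]
  by (simp add: circ_group_def[of "brace_quotient A I"] brace_quotient_def FactGroup_def RCOSETS_def)

lemma skew_brace_quotient:
  assumes I: "brace_ideal I A"
  shows "skew_brace (brace_quotient A I)"
proof -
  interpret N: normal I A using I unfolding brace_ideal_def by blast
  interpret C: normal I "circ_group A" using I unfolding brace_ideal_def by blast
  let ?Q = "brace_quotient A I"
  have Q: "carrier ?Q = rcosets I" "mult ?Q = set_mult A" "one ?Q = I"
    "circ ?Q = set_mult (circ_group A)"
    by (simp_all add: brace_quotient_def FactGroup_def)
  have inv_Q: "inv\<^bsub>?Q\<^esub> X = inv\<^bsub>A Mod I\<^esub> X" for X
    unfolding m_inv_def Q by (simp add: FactGroup_def)
  have g: "group ?Q"
    using N.factorgroup_is_group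
    unfolding group_def group_axioms_def monoid_def Units_def Q by (simp add: FactGroup_def)
  have gc: "group (circ_group ?Q)"
    using C.factorgroup_is_group circ_group_brace_quotient[OF I] by simp
  have circ_Q: "(I #> a) \<odot>\<^bsub>?Q\<^esub> (I #> b) = I #> (a \<odot> b)"
    if "a \<in> carrier A" "b \<in> carrier A" for a b
    using C.rcos_sum[of a b] that brace_ideal_coset_eq[OF I] by (simp add: Q)
  have comp: "X \<odot>\<^bsub>?Q\<^esub> (Y \<otimes>\<^bsub>?Q\<^esub> Z) = (X \<odot>\<^bsub>?Q\<^esub> Y) \<otimes>\<^bsub>?Q\<^esub> inv\<^bsub>?Q\<^esub> X \<otimes>\<^bsub>?Q\<^esub> (X \<odot>\<^bsub>?Q\<^esub> Z)"
    if "X \<in> carrier ?Q" "Y \<in> carrier ?Q" "Z \<in> carrier ?Q" for X Y Z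
  proof -
    from that obtain a b c where abc: "a \<in> carrier A" "b \<in> carrier A" "c \<in> carrier A"
      and X: "X = I #> a" and Y: "Y = I #> b" and Z: "Z = I #> c"
      unfolding Q RCOSETS_def by auto
    have "inv\<^bsub>?Q\<^esub> X = I #> inv a"
      using abc N.inv_FactGroup[of X] N.rcos_inv[of a]
      by (simp add: inv_Q X FactGroup_def rcosetsI N.subset)
    then show ?thesis
      using abc by (simp add: X Y Z Q(2) N.rcos_sum circ_Q compat)
  qed
  show ?thesis
    using g gc comp by (simp add: skew_brace_def skew_brace_axioms_def)
qed

end

end

theory Submission
  imports Defs "HOL-Library.Z2" "HOL-Library.Product_Plus" "HOL-Library.Countable"
begin

text \<open>
  Let \<open>\<lambda>\<^sub>a(b) = a\<^sup>-\<^sup>1 \<cdot> (a \<circ> b)\<close>, and suppose that the coset of \<open>z\<close> lies in the annihilator of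
  \<open>A / Ann A\<close>, with \<open>A\<close> perfect. The maps \<open>x \<mapsto> [z, x]\<close> and \<open>x \<mapsto> z * x\<close> are homomorphisms from
  \<open>(A, \<cdot>)\<close> to \<open>Ann A\<close> that are constant on the orbits of \<open>\<lambda>\<close>, so they vanish on \<open>A * A = A\<close>. But
  \<open>x \<mapsto> x * z\<close> is a homomorphism from \<open>(A, \<circ>)\<close>, and perfectness does not rule those out. So an
  example has to look as follows: \<open>z\<close> is central in \<open>(A, \<cdot>)\<close>, lies in the kernel of \<open>\<lambda>\<close>, and
  \<open>\<lambda>\<^sub>x\<close> multiplies it by the value at \<open>x\<close> of a nontrivial homomorphism from \<open>(A, \<circ>)\<close> to \<open>Ann A\<close>.

  Such a skew brace, of order 384, is built from the field \<open>F\<close> with four elements. Let \<open>N\<close> be the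
  norm from \<open>F\<close> to the field of bits, let \<open>V = F \<times> F\<close>, let \<open>W\<close> be the space of bit triples, and let
  \<open>\<beta>\<close> be the polarization of the \<open>W\<close>-valued quadratic form \<open>Q(x, y) = (N(x + y), N x, N y)\<close> on \<open>V\<close>.
  The involution \<open>\<tau>(x, y) = (y\<^sup>2, x\<^sup>2)\<close> of \<open>V\<close> and the exchange \<open>\<rho>\<close> of the last two coordinates of
  \<open>W\<close> satisfy \<open>Q(\<tau> v) = \<rho>(Q v)\<close>, and scaling by a unit of \<open>F\<close> preserves \<open>Q\<close>, because units have
  norm 1. On the abelian group \<open>F\<^sup>\<times> \<times> V \<times> W\<close> let the bit \<open>e\<close> of \<open>(t, u, s)\<close> be the first coordinate
  of \<open>s + Q u\<close>, and let \<open>(t, u, s)\<close> act by \<open>\<lambda>\<close>, which sends \<open>(t', v, r)\<close> to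
  \<open>(\<phi>\<^sup>e t', w, \<rho>\<^sup>e r + \<beta>(u, w))\<close>, where \<open>w = t \<cdot> \<tau>\<^sup>e v\<close> and \<open>\<phi>\<close> is the Frobenius map. For a single
  form with bit values this is Hegedus' construction of braces, enlarged by the group of units.

  In \<open>a \<circ> b = a \<cdot> \<lambda>\<^sub>a(b)\<close> the term \<open>\<beta>(u, w)\<close> is cancelled in \<open>e\<close> by the failure of \<open>Q\<close> to be
  additive, so \<open>e\<close> is a homomorphism from \<open>(A, \<circ>)\<close> to the bits (\<open>twist_circ\<close>). Therefore \<open>\<lambda>\<close> is an
  action of \<open>(A, \<circ>)\<close> (\<open>lam_act\<close>), which makes \<open>\<circ>\<close> associative.

  The skew brace is perfect (\<open>perfect_brace\<close>): units are reached because \<open>\<lambda>\<close> inverts them when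
  \<open>e = 1\<close>, vectors because a unit other than 1 fixes only the zero vector, and \<open>W\<close> because the three
  components of \<open>\<beta>\<close> are linearly independent. Finally \<open>W\<close> contains the element \<open>(0, 1, 1)\<close> of the
  annihilator (\<open>Ann_diagonal\<close>), and \<open>z = (0, 1, 0)\<close> is moved to \<open>z + (0, 1, 1)\<close> exactly by the elements
  with \<open>e = 1\<close>. So \<open>z\<close> is not in the annihilator, but its coset annihilates the quotient.
\<close>

section \<open>Skew braces and their second annihilator\<close>

text \<open>
  The compatibility law is the additivity of each \<open>l a\<close>, and associativity of \<open>\<odot>\<close> is the action
  law \<open>act\<close>. Surjectivity of \<open>l a\<close> provides right inverses for \<open>\<odot>\<close>.
\<close>

lemma skew_brace_from_lambda:
  fixes A (structure)
  assumes "group A"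
    and circ: "\<And>a b. \<lbrakk>a \<in> carrier A; b \<in> carrier A\<rbrakk> \<Longrightarrow> a \<odot> b = a \<otimes> l a b"
    and closed: "\<And>a b. \<lbrakk>a \<in> carrier A; b \<in> carrier A\<rbrakk> \<Longrightarrow> l a b \<in> carrier A"
    and add: "\<And>a b c. \<lbrakk>a \<in> carrier A; b \<in> carrier A; c \<in> carrier A\<rbrakk>
                \<Longrightarrow> l a (b \<otimes> c) = l a b \<otimes> l a c"
    and act: "\<And>a b c. \<lbrakk>a \<in> carrier A; b \<in> carrier A; c \<in> carrier A\<rbrakk>
                \<Longrightarrow> l (a \<otimes> l a b) c = l a (l b c)"
    and one: "\<And>b. b \<in> carrier A \<Longrightarrow> l \<one> b = b"
    and surj: "\<And>a c. \<lbrakk>a \<in> carrier A; c \<in> carrier A\<rbrakk> \<Longrightarrow> \<exists>b\<in>carrier A. l a b = c"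
  shows "skew_brace A"
proof -
  interpret group A by fact
  have cc: "a \<odot> b \<in> carrier A" if "a \<in> carrier A" "b \<in> carrier A" for a b
    using that by (simp add: circ closed)
  have assoc: "(a \<odot> b) \<odot> c = a \<odot> (b \<odot> c)"
    if "a \<in> carrier A" "b \<in> carrier A" "c \<in> carrier A" for a b c
    using that by (simp add: circ closed add act m_assoc)
  have l1: "\<one> \<odot> b = b" if "b \<in> carrier A" for b
    using that by (simp add: circ one)
  have lone: "l a \<one> = \<one>" if "a \<in> carrier A" for a
  proof -
    have "l a \<one> \<otimes> l a \<one> = l a \<one>"
      using add[of a \<one> \<one>] that by simp
    then show ?thesis
      using that closed by (metis l_cancel_one one_closed)
  qed
  have r1: "b \<odot> \<one> = b" if "b \<in> carrier A" for b
    using that by (simp add: circ lone)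
  have rinv: "\<exists>b\<in>carrier A. a \<odot> b = \<one>" if a: "a \<in> carrier A" for a
  proof -
    obtain b where "b \<in> carrier A" "l a b = inv a" using surj a by blast
    then show ?thesis using a by (metis circ r_inv)
  qed
  have linv: "\<exists>b\<in>carrier A. b \<odot> a = \<one>" if a: "a \<in> carrier A" for a
  proof -
    obtain b where b: "b \<in> carrier A" "a \<odot> b = \<one>" using rinv a by blast
    obtain c where c: "c \<in> carrier A" "b \<odot> c = \<one>" using rinv b by blast
    have "a = c" using assoc[of a b c] a b c by (simp add: r1 l1)
    with b c show ?thesis by auto
  qed
  have "group (circ_group A)"
    by (rule groupI) (auto simp: cc assoc l1 linv)
  moreover have "a \<odot> (b \<otimes> c) = (a \<odot> b) \<otimes> inv a \<otimes> (a \<odot> c)"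
    if "a \<in> carrier A" "b \<in> carrier A" "c \<in> carrier A" for a b c
    using that by (simp add: circ closed add m_assoc inv_solve_left') (simp add: m_assoc[symmetric] closed)
  ultimately show ?thesis
    using is_group by (simp add: skew_brace_def skew_brace_axioms_def)
qed

context skew_brace
begin

text \<open>
  The three congruences modulo \<open>Ann A\<close> are the equations that characterize membership of the coset
  of \<open>z\<close> in the annihilator of the quotient.
\<close>

lemma Ann_quotient_nontrivial:
  assumes z: "z \<in> carrier A" "z \<notin> Ann A"
    and zx: "\<And>x. x \<in> carrier A \<Longrightarrow> z \<odot> x \<in> Ann A #> (z \<otimes> x)"
    and xz: "\<And>x. x \<in> carrier A \<Longrightarrow> x \<odot> z \<in> Ann A #> (z \<otimes> x)"
    and cz: "\<And>x. x \<in> carrier A \<Longrightarrow> x \<otimes> z \<in> Ann A #> (z \<otimes> x)"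
  shows "Ann (brace_quotient A (Ann A)) \<noteq> {\<one>\<^bsub>brace_quotient A (Ann A)\<^esub>}"
proof -
  let ?I = "Ann A" and ?Q = "brace_quotient A (Ann A)"
  interpret Q: skew_brace ?Q by (rule skew_brace_quotient[OF brace_ideal_Ann])
  interpret N: normal ?I A using brace_ideal_Ann unfolding brace_ideal_def by blast
  interpret C: normal ?I "circ_group A" using brace_ideal_Ann unfolding brace_ideal_def by blast
  have Q: "carrier ?Q = rcosets ?I" "mult ?Q = set_mult A" "one ?Q = ?I"
    "circ ?Q = set_mult (circ_group A)"
    by (simp_all add: brace_quotient_def FactGroup_def)
  have circ_Q: "(?I #> a) \<odot>\<^bsub>?Q\<^esub> (?I #> b) = ?I #> (a \<odot> b)"
    if "a \<in> carrier A" "b \<in> carrier A" for a b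
    using C.rcos_sum[of a b] that brace_ideal_coset_eq[OF brace_ideal_Ann] by (simp add: Q)
  have eq: "?I #> x = ?I #> y" if "x \<in> ?I #> y" "y \<in> carrier A" for x y
    using repr_independence[OF that N.subgroup_axioms] by simp
  have "?I #> z \<in> Ann ?Q"
    unfolding Q.Ann_iff
  proof (intro conjI ballI)
    show "?I #> z \<in> carrier ?Q" using z by (simp add: Q rcosetsI N.subset)
    fix X assume "X \<in> carrier ?Q"
    then obtain x where x: "x \<in> carrier A" "X = ?I #> x" unfolding Q RCOSETS_def by auto
    show "(?I #> z) \<odot>\<^bsub>?Q\<^esub> X = (?I #> z) \<otimes>\<^bsub>?Q\<^esub> X"
      "X \<odot>\<^bsub>?Q\<^esub> (?I #> z) = (?I #> z) \<otimes>\<^bsub>?Q\<^esub> X"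
      "X \<otimes>\<^bsub>?Q\<^esub> (?I #> z) = (?I #> z) \<otimes>\<^bsub>?Q\<^esub> X"
      using x z eq[OF zx] eq[OF xz] eq[OF cz] by (simp_all add: circ_Q Q(2) N.rcos_sum)
  qed
  moreover have "?I #> z \<noteq> ?I" using z rcos_self[OF z(1) N.subgroup_axioms] by auto
  ultimately show ?thesis by (auto simp: Q)
qed

end

section \<open>Copying a countable skew brace to the natural numbers\<close>

definition nat_copy :: "('a::countable) skew_brace \<Rightarrow> nat skew_brace" where
  "nat_copy A = \<lparr>carrier = to_nat ` carrier A,
     mult = (\<lambda>m n. to_nat (from_nat m \<otimes>\<^bsub>A\<^esub> from_nat n :: 'a)),
     one = to_nat \<one>\<^bsub>A\<^esub>,
     circ = (\<lambda>m n. to_nat (from_nat m \<odot>\<^bsub>A\<^esub> from_nat n :: 'a))\<rparr>"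

context
  fixes A :: "('a::countable) skew_brace" (structure)
  assumes sb: "skew_brace A"
begin

interpretation skew_brace A by (rule sb)

lemma nat_copy_simps:
  "carrier (nat_copy A) = to_nat ` carrier A" "\<one>\<^bsub>nat_copy A\<^esub> = to_nat \<one>"
  "to_nat a \<otimes>\<^bsub>nat_copy A\<^esub> to_nat b = to_nat (a \<otimes> b)"
  "to_nat a \<odot>\<^bsub>nat_copy A\<^esub> to_nat b = to_nat (a \<odot> b)"
  by (simp_all add: nat_copy_def)

lemma group_nat_copy: "group (nat_copy A)"
  by (rule groupI) (auto simp: nat_copy_simps m_assoc)

lemma inv_nat_copy:
  assumes "a \<in> carrier A"
  shows "inv\<^bsub>nat_copy A\<^esub> (to_nat a) = to_nat (inv a)"
  using assms by (intro group.inv_equality[OF group_nat_copy]) (auto simp: nat_copy_simps)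

lemma skew_brace_nat_copy: "skew_brace (nat_copy A)"
proof -
  have "\<exists>b\<in>carrier A. b \<odot> a = \<one>" if "a \<in> carrier A" for a
    using circ.l_inv_ex[of a] that by simp
  then have "group (circ_group (nat_copy A))"
    by (intro groupI) (use circ.m_assoc circ.l_one in \<open>auto simp: nat_copy_simps\<close>)
  then show ?thesis
    using group_nat_copy
    by (auto simp: skew_brace_def skew_brace_axioms_def nat_copy_simps inv_nat_copy compat)
qed

lemma Ann_nat_copy: "to_nat a \<in> Ann (nat_copy A) \<longleftrightarrow> a \<in> Ann A"
  unfolding Ann_iff skew_brace.Ann_iff[OF skew_brace_nat_copy]
  by (auto simp: nat_copy_simps)

lemma brace_star_nat_copy:
  assumes "a \<in> carrier A" "b \<in> carrier A"
  shows "brace_star (nat_copy A) (to_nat a) (to_nat b) = to_nat (brace_star A a b)"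
  using assms by (simp add: brace_star_def nat_copy_simps inv_nat_copy)

lemma perfect_nat_copy:
  assumes "perfect A"
  shows "perfect (nat_copy A)"
proof -
  interpret h: group_hom A "nat_copy A" to_nat
    by unfold_locales (use group_nat_copy in
      \<open>auto simp: group_def group_axioms_def hom_def nat_copy_simps monoid_def Units_def\<close>)
  let ?S = "{brace_star A x y | x y. x \<in> carrier A \<and> y \<in> carrier A}"
  have "?S \<subseteq> carrier A" by (auto simp: brace_star_def)
  then have "to_nat ` generate A ?S = generate (nat_copy A) (to_nat ` ?S)"
    by (rule h.generate_img[symmetric])
  moreover have "to_nat ` ?S = {brace_star (nat_copy A) x y | x y.
      x \<in> carrier (nat_copy A) \<and> y \<in> carrier (nat_copy A)}"
    by (auto simp: nat_copy_simps brace_star_nat_copy) (force simp: brace_star_nat_copy)+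
  ultimately show ?thesis
    using assms by (simp add: perfect_def brace_star_set_def nat_copy_simps)
qed

lemma nat_copy_second_annihilator:
  assumes z: "z \<in> carrier A" "z \<notin> Ann A"
    and zx: "\<And>x. x \<in> carrier A \<Longrightarrow> \<exists>c\<in>Ann A. z \<odot> x = c \<otimes> (z \<otimes> x)"
    and xz: "\<And>x. x \<in> carrier A \<Longrightarrow> \<exists>c\<in>Ann A. x \<odot> z = c \<otimes> (z \<otimes> x)"
    and cz: "\<And>x. x \<in> carrier A \<Longrightarrow> \<exists>c\<in>Ann A. x \<otimes> z = c \<otimes> (z \<otimes> x)"
  shows "Ann (brace_quotient (nat_copy A) (Ann (nat_copy A)))
    \<noteq> {\<one>\<^bsub>brace_quotient (nat_copy A) (Ann (nat_copy A))\<^esub>}"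
proof (rule skew_brace.Ann_quotient_nontrivial[OF skew_brace_nat_copy])
  show "to_nat z \<in> carrier (nat_copy A)" "to_nat z \<notin> Ann (nat_copy A)"
    using z by (simp_all add: nat_copy_simps Ann_nat_copy)
  have coset: "to_nat y \<in> Ann (nat_copy A) #>\<^bsub>nat_copy A\<^esub> to_nat x"
    if "\<exists>c\<in>Ann A. y = c \<otimes> x" for x y
  proof -
    from that obtain c where "c \<in> Ann A" "y = c \<otimes> x" by blast
    then have "to_nat c \<in> Ann (nat_copy A)" "to_nat y = to_nat c \<otimes>\<^bsub>nat_copy A\<^esub> to_nat x"
      by (simp_all add: Ann_nat_copy nat_copy_simps)
    then show ?thesis unfolding r_coset_def by blast
  qed
  fix m assume "m \<in> carrier (nat_copy A)"
  then obtain x where x: "x \<in> carrier A" "m = to_nat x" by (auto simp: nat_copy_simps)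
  show "to_nat z \<odot>\<^bsub>nat_copy A\<^esub> m \<in> Ann (nat_copy A) #>\<^bsub>nat_copy A\<^esub> (to_nat z \<otimes>\<^bsub>nat_copy A\<^esub> m)"
    "m \<odot>\<^bsub>nat_copy A\<^esub> to_nat z \<in> Ann (nat_copy A) #>\<^bsub>nat_copy A\<^esub> (to_nat z \<otimes>\<^bsub>nat_copy A\<^esub> m)"
    "m \<otimes>\<^bsub>nat_copy A\<^esub> to_nat z \<in> Ann (nat_copy A) #>\<^bsub>nat_copy A\<^esub> (to_nat z \<otimes>\<^bsub>nat_copy A\<^esub> m)"
    using coset[OF zx[OF x(1)]] coset[OF xz[OF x(1)]] coset[OF cz[OF x(1)]]
    by (simp_all add: x nat_copy_simps)
qed

end

section \<open>The field with four elements\<close>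

instance bit :: finite
  by standard (rule finite_subset[of _ "{0,1}"], use bit.exhaust in auto)

text \<open>
  Bits are used as the field with two elements: without these rewrite rules, sums and products of
  bits stay accessible to the ring simplification rules.
\<close>

declare add_bit_eq_xor [simp del] mult_bit_eq_and [simp del]

text \<open>
  \<open>F4 a b\<close> stands for \<open>a + b \<omega>\<close> with \<open>\<omega>\<^sup>2 = \<omega> + 1\<close>.
\<close>

datatype f4 = F4 bit bit

instance f4 :: countable by countable_datatype

lemma f4_cases:
  obtains "x = F4 0 0" | "x = F4 0 1" | "x = F4 1 0" | "x = F4 1 1"
  by (cases x) (metis bit.exhaust)

instantiation f4 :: comm_ring_1
begin
definition "0 = F4 0 0"
definition "1 = F4 1 0"
fun plus_f4 where "F4 a b + F4 c d = F4 (a + c) (b + d)"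
fun times_f4 where "F4 a b * F4 c d = F4 (a * c + b * d) (a * d + b * c + b * d)"
definition "- (x::f4) = x"
definition "(x::f4) - y = x + y"
instance
proof
  fix a b c :: f4
  show "a + b + c = a + (b + c)"
    by (cases a rule: f4_cases; cases b rule: f4_cases; cases c rule: f4_cases; simp)
  show "a + b = b + a" by (cases a rule: f4_cases; cases b rule: f4_cases; simp)
  show "0 + a = a" by (cases a) (simp add: zero_f4_def)
  show "- a + a = 0" by (cases a rule: f4_cases; simp add: zero_f4_def uminus_f4_def)
  show "a - b = a + - b" by (simp add: minus_f4_def uminus_f4_def)
  show "a * b * c = a * (b * c)"
    by (cases a rule: f4_cases; cases b rule: f4_cases; cases c rule: f4_cases; simp)
  show "a * b = b * a" by (cases a rule: f4_cases; cases b rule: f4_cases; simp)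
  show "1 * a = a" by (cases a) (simp add: one_f4_def)
  show "(a + b) * c = a * c + b * c"
    by (cases a rule: f4_cases; cases b rule: f4_cases; cases c rule: f4_cases; simp)
  show "(0::f4) \<noteq> 1" by (simp add: zero_f4_def one_f4_def)
qed
end

text \<open>
  The norm \<open>x \<mapsto> x\<^sup>3\<close> to the subfield \<open>{0, 1}\<close>, with bits as values: it is
  \<open>a\<^sup>2 + a b + b\<^sup>2\<close>, and \<open>a\<^sup>2 = a\<close> for bits.
\<close>

fun norm4 :: "f4 \<Rightarrow> bit" where "norm4 (F4 a b) = a + a * b + b"

definition polar :: "f4 \<Rightarrow> f4 \<Rightarrow> bit" where
  "polar x y = norm4 (x + y) + norm4 x + norm4 y"

text \<open>
  The exponent of the Frobenius automorphism is a bit because the automorphism has order 2. On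
  units it is the inversion, see \<open>f4_cube\<close>.
\<close>

definition frob :: "bit \<Rightarrow> f4 \<Rightarrow> f4" where
  "frob e x = (if e = 1 then x * x else x)"

lemma f4_double [simp]: "x + x = (0::f4)"
  by (cases x rule: f4_cases; simp add: zero_f4_def)

lemma f4_cube: "x \<noteq> 0 \<Longrightarrow> x * (x * x) = (1::f4)"
  by (cases x rule: f4_cases; simp add: zero_f4_def one_f4_def)

lemma f4_mult_nonzero: "x \<noteq> 0 \<Longrightarrow> y \<noteq> 0 \<Longrightarrow> x * y \<noteq> (0::f4)"
  by (cases x rule: f4_cases; cases y rule: f4_cases; simp add: zero_f4_def)

lemma bit_double [simp]: "x + x = (0::bit)" "x + (x + y) = (y::bit)"
  by (cases x; simp)+

lemma frob_add: "frob e (x + y) = frob e x + frob e y"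
  by (cases x rule: f4_cases; cases y rule: f4_cases; simp add: frob_def zero_f4_def)

lemma frob_mult: "frob e (x * y) = frob e x * frob e y"
  by (simp add: frob_def mult_ac)

lemma frob_frob: "frob e (frob d x) = frob (e + d) x"
  by (cases x rule: f4_cases; cases e; cases d; simp add: frob_def)

lemma frob_0 [simp]: "frob 0 x = x"
  by (simp add: frob_def)

lemma frob_zero_one [simp]: "frob e 0 = 0" "frob e 1 = 1"
  by (simp_all add: frob_def)

lemma frob_nonzero: "x \<noteq> 0 \<Longrightarrow> frob e x \<noteq> 0"
  by (simp add: frob_def f4_mult_nonzero)

lemma norm4_frob: "norm4 (frob e x) = norm4 x"
  by (cases x rule: f4_cases; simp add: frob_def)

lemma norm4_unit: "t \<noteq> 0 \<Longrightarrow> norm4 (t * x) = norm4 x"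
  by (cases x rule: f4_cases; cases t rule: f4_cases; simp add: zero_f4_def)

lemma norm4_add: "norm4 (x + y) = norm4 x + norm4 y + polar x y"
  by (simp add: polar_def ac_simps)

lemma polar_add_right: "polar x (y + z) = polar x y + polar x z"
  by (cases x rule: f4_cases; cases y rule: f4_cases; cases z rule: f4_cases;
      simp add: polar_def zero_f4_def)

section \<open>A vector-valued quadratic form and its symmetries\<close>

type_synonym quad_space = "f4 \<times> f4"
type_synonym value_space = "bit \<times> bit \<times> bit"

text \<open>
  Three forms are needed: the first one enters the homomorphism to the bits and therefore has to be
  invariant under the exchange of the coordinates of \<open>(x, y)\<close>; the other two are exchanged by it,
  which creates the unipotent action on the values.
\<close>

fun quad :: "quad_space \<Rightarrow> value_space" where
  "quad (x, y) = (norm4 (x + y), norm4 x, norm4 y)"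

fun bil :: "quad_space \<Rightarrow> quad_space \<Rightarrow> value_space" where
  "bil (x, y) (x', y') = (polar (x + y) (x' + y'), polar x x', polar y y')"

fun scale :: "f4 \<Rightarrow> quad_space \<Rightarrow> quad_space" where
  "scale t (x, y) = (t * x, t * y)"

fun tau :: "bit \<Rightarrow> quad_space \<Rightarrow> quad_space" where
  "tau e (x, y) = (if e = 1 then (frob 1 y, frob 1 x) else (x, y))"

fun rho :: "bit \<Rightarrow> value_space \<Rightarrow> value_space" where
  "rho e (a, b, c) = (if e = 1 then (a, c, b) else (a, b, c))"

lemma value_double [simp]: "w + w = (0::value_space)" "w + (w + w') = (w'::value_space)"
  by (cases w; cases w'; simp add: zero_prod_def)+

lemma vector_double [simp]: "v + v = (0::quad_space)"
  by (cases v; simp add: zero_prod_def)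

lemma quad_zero [simp]: "quad 0 = 0"
  by (simp add: zero_prod_def zero_f4_def)

lemma quad_add: "quad (u + v) = quad u + quad v + bil u v"
proof (cases u; cases v)
  fix x y x' y' assume uv: "u = (x, y)" "v = (x', y')"
  have "(x + x') + (y + y') = (x + y) + (x' + y')" by (simp only: ac_simps)
  then show ?thesis
    by (simp only: uv quad.simps bil.simps add_Pair norm4_add[of "x + y"] norm4_add[of x x']
      norm4_add[of y y'])
qed

lemma quad_scale: "t \<noteq> 0 \<Longrightarrow> quad (scale t v) = quad v"
  by (cases v) (simp add: norm4_unit flip: distrib_left)

lemma quad_tau: "quad (tau e v) = rho e (quad v)"
  by (cases v) (simp add: norm4_frob add.commute flip: frob_add)

lemma bil_eq_quad: "bil u v = quad (u + v) + quad u + quad v"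
  by (simp add: quad_add ac_simps)

lemma bil_add_right: "bil u (v + w) = bil u v + bil u w"
  by (cases u; cases v; cases w) (simp add: polar_add_right ac_simps)

lemma bil_commute: "bil u v = bil v u"
  by (simp add: bil_eq_quad ac_simps)

lemma bil_add_left: "bil (u + v) w = bil u w + bil v w"
  by (metis bil_commute bil_add_right)

lemma bil_zero [simp]: "bil 0 v = 0" "bil v 0 = 0"
  by (simp_all add: bil_eq_quad)

lemma scale_add: "scale t (u + v) = scale t u + scale t v"
  by (cases u; cases v) (simp add: distrib_left)

lemma tau_add: "tau e (u + v) = tau e u + tau e v"
  by (cases u; cases v) (simp add: frob_add)

lemma rho_add: "rho e (u + v) = rho e u + rho e v"
  by (cases u; cases v) simp

lemma scale_scale: "scale t (scale t' v) = scale (t * t') v"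
  by (cases v) (simp add: mult_ac)

lemma scale_one [simp]: "scale 1 v = v"
  by (cases v) simp

lemma tau_tau: "tau e (tau d v) = tau (e + d) v"
  by (cases v; cases e; cases d) (simp_all add: frob_frob)

lemma rho_rho: "rho e (rho d w) = rho (e + d) w"
  by (cases w; cases e; cases d) simp_all

lemma tau_0 [simp]: "tau 0 v = v" by (cases v) simp
lemma rho_0 [simp]: "rho 0 w = w" by (cases w) simp

lemma tau_zero [simp]: "tau e 0 = 0" by (simp add: zero_prod_def)
lemma rho_zero [simp]: "rho e 0 = 0" by (simp add: zero_prod_def)
lemma scale_zero [simp]: "scale t 0 = 0" by (simp add: zero_prod_def)

lemma fst_rho [simp]: "fst (rho e w) = fst w"
  by (cases w) simp

text \<open>
  On units the Frobenius map is the inversion, so this is the relation of a dihedral group; it makes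
  the scaled powers of \<open>tau\<close> multiply like elements of a semidirect product.
\<close>

lemma tau_scale: "tau e (scale t v) = scale (frob e t) (tau e v)"
  by (cases v; cases e) (simp_all add: frob_mult)

lemma bil_scale: "t \<noteq> 0 \<Longrightarrow> bil (scale t u) (scale t v) = bil u v"
  by (simp add: bil_eq_quad quad_scale flip: scale_add)

lemma bil_tau: "bil (tau e u) (tau e v) = rho e (bil u v)"
  by (simp add: bil_eq_quad quad_tau rho_add flip: tau_add)

section \<open>A perfect skew brace of order 384\<close>

type_synonym elt = "f4 \<times> quad_space \<times> value_space"

definition twist :: "elt \<Rightarrow> bit" where
  "twist = (\<lambda>(t, u, s). fst (s + quad u))"

definition add :: "elt \<Rightarrow> elt \<Rightarrow> elt" where
  "add = (\<lambda>(t, u, s) (t', u', s'). (t * t', u + u', s + s'))"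

text \<open>
  The summand \<open>bil u w\<close> is forced by the requirement that \<open>twist\<close> be a homomorphism for the
  circle operation: it compensates for \<open>quad\<close> not being additive.
\<close>

definition lam :: "elt \<Rightarrow> elt \<Rightarrow> elt" where
  "lam a = (\<lambda>(t', v, r). case a of (t, u, s) \<Rightarrow>
     let e = twist a; w = scale t (tau e v) in (frob e t', w, rho e r + bil u w))"

definition brace :: "elt skew_brace" where
  "brace = \<lparr>carrier = {(t, u, s). t \<noteq> 0}, mult = add, one = (1, 0, 0),
     circ = (\<lambda>a b. add a (lam a b))\<rparr>"

lemma brace_simps:
  "(t, u, s) \<in> carrier brace \<longleftrightarrow> t \<noteq> 0"
  "(t, u, s) \<otimes>\<^bsub>brace\<^esub> (t', u', s') = (t * t', u + u', s + s')"
  "\<one>\<^bsub>brace\<^esub> = (1, 0, 0)"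
  "a \<odot>\<^bsub>brace\<^esub> b = a \<otimes>\<^bsub>brace\<^esub> lam a b"
  by (auto simp: brace_def add_def)

lemma lam_simp:
  "lam (t, u, s) (t', v, r) = (let e = twist (t, u, s); w = scale t (tau e v)
     in (frob e t', w, rho e r + bil u w))"
  by (simp add: lam_def)

lemma elt_cases: obtains t u s where "a = ((t, u, s) :: elt)"
  by (metis prod_cases3)

lemma group_brace: "group brace"
proof (rule groupI)
  show "\<exists>b\<in>carrier brace. b \<otimes>\<^bsub>brace\<^esub> a = \<one>\<^bsub>brace\<^esub>" if a: "a \<in> carrier brace" for a
  proof -
    obtain t u s where tus: "a = (t, u, s)" by (rule elt_cases)
    with a have "(t * t, u, s) \<otimes>\<^bsub>brace\<^esub> a = \<one>\<^bsub>brace\<^esub>" "(t * t, u, s) \<in> carrier brace"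
      using f4_cube[of t]
      by (simp_all only: tus brace_simps f4_mult_nonzero mult_ac vector_double value_double simp_thms)
    then show ?thesis by blast
  qed
  fix a b c :: elt
  obtain t u s where a: "a = (t, u, s)" by (rule elt_cases)
  obtain t' u' s' where b: "b = (t', u', s')" by (rule elt_cases)
  obtain t'' u'' s'' where c: "c = (t'', u'', s'')" by (rule elt_cases)
  show "a \<otimes>\<^bsub>brace\<^esub> b \<otimes>\<^bsub>brace\<^esub> c = a \<otimes>\<^bsub>brace\<^esub> (b \<otimes>\<^bsub>brace\<^esub> c)"
    by (simp only: a b c brace_simps mult.assoc add.assoc)
  show "a \<otimes>\<^bsub>brace\<^esub> b \<in> carrier brace" if "a \<in> carrier brace" "b \<in> carrier brace"
    using that by (simp only: a b brace_simps f4_mult_nonzero simp_thms)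
  show "\<one>\<^bsub>brace\<^esub> \<otimes>\<^bsub>brace\<^esub> a = a"
    by (simp only: a brace_simps mult_1 add_0)
qed (simp add: brace_simps)

lemma inv_brace: "t \<noteq> 0 \<Longrightarrow> inv\<^bsub>brace\<^esub> (t, u, s) = (t * t, u, s)"
  using f4_cube[of t]
  by (intro group.inv_equality[OF group_brace])
    (simp_all add: brace_simps f4_mult_nonzero mult.assoc)

text \<open>
  The two contributions \<open>bil u w\<close> cancel, one from \<open>lam\<close> and one from expanding \<open>quad (u + w)\<close>. The
  maps \<open>rho e\<close> disappear because they fix the first coordinate.
\<close>

lemma twist_circ:
  assumes "a \<in> carrier brace"
  shows "twist (a \<otimes>\<^bsub>brace\<^esub> lam a b) = twist a + twist b"
proof -
  obtain t u s where a: "a = (t, u, s)" by (rule elt_cases)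
  obtain t' u' s' where b: "b = (t', u', s')" by (rule elt_cases)
  have t: "t \<noteq> 0" using assms by (simp add: a brace_simps)
  define e where "e = twist a"
  have "twist (a \<otimes>\<^bsub>brace\<^esub> lam a b) = fst (s + quad u + rho e (s' + quad u') + (bil u (scale t (tau e u')) + bil u (scale t (tau e u'))))"
    by (simp only: a b lam_simp Let_def brace_simps twist_def prod.case e_def quad_add rho_add
      quad_scale[OF t] quad_tau ac_simps)
  also have "\<dots> = twist a + twist b"
    by (simp only: a b twist_def prod.case value_double add_0_right fst_add fst_rho)
  finally show ?thesis .
qed

text \<open>
  With \<open>e\<close> additive for \<open>\<odot>\<close>, the first two components are an action by semidirect product rules. In
  the third one \<open>bil\<close> is additive in its left argument and \<open>(x \<mapsto> scale t (tau e x), rho e)\<close>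
  transforms it equivariantly.
\<close>

lemma lam_act:
  assumes "a \<in> carrier brace"
  shows "lam (a \<otimes>\<^bsub>brace\<^esub> lam a b) c = lam a (lam b c)"
proof -
  obtain t u s t' u' s' x v r where abc: "a = (t, u, s)" "b = (t', u', s')" "c = (x, v, r)"
    by (metis elt_cases)
  have t: "t \<noteq> 0" using assms by (simp add: abc brace_simps)
  define e e' where "e = twist a" and "e' = twist b"
  define w where "w = scale t' (tau e' v)"
  have w: "scale (t * frob e t') (tau (e + e') v) = scale t (tau e w)"
    by (simp only: w_def tau_scale tau_tau scale_scale)
  have "bil (u + scale t (tau e u')) (scale t (tau e w))
      = bil u (scale t (tau e w)) + rho e (bil u' w)"
    by (simp only: bil_add_left bil_scale[OF t] bil_tau)
  moreover have "lam b c = (frob e' x, w, rho e' r + bil u' w)"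
    by (simp add: abc(2,3) lam_simp Let_def w_def e'_def)
  moreover have "fst (a \<otimes>\<^bsub>brace\<^esub> lam a b) = t * frob e t'"
    "fst (snd (a \<otimes>\<^bsub>brace\<^esub> lam a b)) = u + scale t (tau e u')"
    by (simp_all add: abc(1,2) lam_simp Let_def e_def brace_simps)
  moreover have "twist (a \<otimes>\<^bsub>brace\<^esub> lam a b) = e + e'"
    using twist_circ[OF assms] by (simp add: e_def e'_def)
  moreover have "lam a (frob e' x, w, rho e' r + bil u' w) = (frob (e + e') x,
      scale t (tau e w), rho (e + e') r + (bil u (scale t (tau e w)) + rho e (bil u' w)))"
    by (simp only: abc(1) lam_simp Let_def e_def frob_frob rho_add rho_rho ac_simps)
  ultimately show ?thesis
    by (cases "a \<otimes>\<^bsub>brace\<^esub> lam a b" rule: elt_cases)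
      (simp only: abc(3) lam_simp Let_def w fst_conv snd_conv)
qed


lemma skew_brace_brace: "skew_brace brace"
proof (rule skew_brace_from_lambda[where l = lam])
  show "group brace" by (rule group_brace)
  fix a b c :: elt
  obtain t u s where a: "a = (t, u, s)" by (rule elt_cases)
  obtain t' u' s' where b: "b = (t', u', s')" by (rule elt_cases)
  obtain t'' u'' s'' where c: "c = (t'', u'', s'')" by (rule elt_cases)
  show "a \<odot>\<^bsub>brace\<^esub> b = a \<otimes>\<^bsub>brace\<^esub> lam a b" by (rule brace_simps)
  show "lam a b \<in> carrier brace" if "b \<in> carrier brace"
    using that by (simp only: a b brace_simps lam_simp Let_def frob_nonzero simp_thms)
  show "lam a (b \<otimes>\<^bsub>brace\<^esub> c) = lam a b \<otimes>\<^bsub>brace\<^esub> lam a c"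
    by (simp only: a b c brace_simps lam_simp Let_def frob_mult tau_add scale_add rho_add
      bil_add_right ac_simps)
  show "lam (a \<otimes>\<^bsub>brace\<^esub> lam a b) c = lam a (lam b c)" if "a \<in> carrier brace"
    using that by (rule lam_act)
  show "lam \<one>\<^bsub>brace\<^esub> b = b"
    by (simp add: b brace_simps lam_simp Let_def twist_def del: quad.simps)
  show "\<exists>b\<in>carrier brace. lam a b = c" if "a \<in> carrier brace" "c \<in> carrier brace"
  proof
    let ?e = "twist a"
    let ?b = "(frob ?e t'', tau ?e (scale (t * t) u''), rho ?e (s'' + bil u u''))"
    have "t \<noteq> 0" using that by (simp add: a brace_simps)
    then have "scale t (tau ?e (tau ?e (scale (t * t) u''))) = u''"
      by (simp add: tau_tau scale_scale mult.assoc f4_cube)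
    then show "lam a ?b = c"
      by (simp only: a c lam_simp Let_def frob_frob rho_rho bit_double frob_0 rho_0 value_double add_0 ac_simps)
    show "?b \<in> carrier brace" using that by (simp only: c brace_simps frob_nonzero simp_thms)
  qed
qed

interpretation brace: skew_brace brace by (rule skew_brace_brace)

lemma brace_star_brace:
  assumes "t \<noteq> 0" "t' \<noteq> 0"
  shows "brace_star brace (t, u, s) (t', v, r) = lam (t, u, s) (t', v, r) \<otimes>\<^bsub>brace\<^esub> (t' * t', v, r)"
proof -
  have c: "(t, u, s) \<in> carrier brace" "(t', v, r) \<in> carrier brace"
    "lam (t, u, s) (t', v, r) \<in> carrier brace"
    using assms by (simp_all add: brace_simps lam_simp Let_def frob_nonzero)
  then show ?thesis
    by (simp add: brace_star_def brace_simps(4) inv_brace[OF assms(2)] flip: brace.m_assoc)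
qed

text \<open>
  The acting element has \<open>twist\<close> equal to 1, so it inverts \<open>t\<close>, and the inverse squared is \<open>t\<close> again
  because \<open>t\<^sup>3 = 1\<close>.
\<close>

lemma star_unit:
  assumes "t \<noteq> 0"
  shows "brace_star brace (1, 0, (1, 0, 0)) (t, 0, 0) = (t, 0, 0)"
proof -
  have "t * t * (t * t) = t" using f4_cube[OF assms] by (metis mult.assoc mult_1 mult.commute)
  then show ?thesis using assms brace_star_brace[of 1 t 0 "(1, 0, 0)" 0 0]
    by (simp add: lam_simp Let_def twist_def brace_simps frob_def)
qed

abbreviation omega :: f4 where "omega \<equiv> F4 0 1"

lemma omega_nonzero: "omega \<noteq> 0"
  by (simp add: zero_f4_def)

text \<open>
  Here \<open>\<omega> - 1 = \<omega>\<^sup>2\<close> is inverse to \<open>\<omega>\<close>.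
\<close>

lemma star_quad:
  "brace_star brace (omega, 0, 0) (1, scale omega u, 0) = (1, u, 0)"
proof -
  have "omega * (omega * x) + omega * x = x" for x
    by (cases x rule: f4_cases; simp add: zero_f4_def)
  then have "scale omega (scale omega u) + scale omega u = u"
    by (cases u) simp
  then show ?thesis using omega_nonzero brace_star_brace[of omega 1 0 0 "scale omega u" 0]
    by (simp add: lam_simp Let_def twist_def brace_simps)
qed

text \<open>
  The third component \<open>quad (1, omega)\<close> of the acting element makes its \<open>twist\<close> vanish, so that
  the star product is \<open>bil (1, omega) v\<close>, where \<open>v\<close> is the vector acted on. As \<open>polar omega x\<close> and
  \<open>polar 1 x\<close> are the two coordinates of \<open>x\<close> in the basis of \<open>1\<close> and \<open>\<omega>\<close>, the vector \<open>v\<close> is found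
  by solving three linear equations.
\<close>

lemma star_value:
  "brace_star brace (1, (1, omega), quad (1, omega)) (1, (F4 (a + b + c) b, F4 c 0), 0)
    = (1, 0, (a, b, c))"
proof -
  have "bil (1, omega) (F4 (a + b + c) b, F4 c 0) = (a, b, c)"
    by (cases a; cases b; cases c; simp add: polar_def one_f4_def zero_f4_def)
  then show ?thesis
    using brace_star_brace[of 1 1 "(1, omega)" "quad (1, omega)" "(F4 (a + b + c) b, F4 c 0)" 0]
    by (simp add: lam_simp Let_def twist_def brace_simps del: quad.simps bil.simps plus_f4.simps add_Pair)
qed

lemma perfect_brace: "perfect brace"
proof -
  let ?S = "{brace_star brace x y | x y. x \<in> carrier brace \<and> y \<in> carrier brace}"
  have star: "brace_star brace x y \<in> generate brace ?S"
    if "x \<in> carrier brace" "y \<in> carrier brace" for x y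
    using that by (blast intro: generate.incl)
  have "a \<in> generate brace ?S" if a: "a \<in> carrier brace" for a
  proof -
    obtain t u x y z where tus: "a = (t, u, (x, y, z))" by (metis prod_cases5)
    have t: "t \<noteq> 0" using a by (simp add: tus brace_simps)
    have "(t, 0, 0) \<in> generate brace ?S" "(1, u, 0) \<in> generate brace ?S"
      "(1, 0, (x, y, z)) \<in> generate brace ?S"
      by (subst star_unit[OF t, symmetric] star_quad[symmetric] star_value[symmetric],
          rule star; use t omega_nonzero in \<open>simp add: brace_simps\<close>)+
    then have "(t, 0, 0) \<otimes>\<^bsub>brace\<^esub> (1, u, 0) \<otimes>\<^bsub>brace\<^esub> (1, 0, (x, y, z)) \<in> generate brace ?S"
      by (intro generate.eng)
    then show ?thesis by (simp add: tus brace_simps)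
  qed
  moreover have "generate brace ?S \<subseteq> carrier brace"
    by (rule brace.generate_incl) (auto simp: brace_star_def)
  ultimately show ?thesis unfolding perfect_def brace_star_set_def by blast
qed

lemma lam_value: "lam a (1, 0, r) = (1, 0, rho (twist a) r)"
  by (cases a rule: elt_cases) (simp add: lam_simp Let_def)

text \<open>
  The \<open>twist\<close> of a value is its first coordinate. If it vanishes, the value is in the annihilator
  as soon as \<open>rho\<close> fixes it, by \<open>lam_value\<close> and \<open>value_central\<close>.
\<close>

lemma lam_kernel: "fst w = 0 \<Longrightarrow> lam (1, 0, w) b = b"
  by (cases b rule: elt_cases) (simp add: lam_simp Let_def twist_def)

lemma value_central: "(1, 0, w) \<otimes>\<^bsub>brace\<^esub> b = b \<otimes>\<^bsub>brace\<^esub> (1, 0, w)"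
  by (cases b rule: elt_cases) (simp add: brace_simps add.commute)

lemma Ann_diagonal: "(1, 0, (0, b, b)) \<in> Ann brace"
  unfolding brace.Ann_iff
  by (simp add: brace_simps lam_value lam_kernel value_central)

theorem corollary1p9:
  shows "\<exists>A :: nat skew_brace.
    skew_brace A \<and> perfect A \<and>
    Ann (brace_quotient A (Ann A)) \<noteq> {\<one>\<^bsub>brace_quotient A (Ann A)\<^esub>}"
proof (intro exI conjI)
  show "skew_brace (nat_copy brace)" by (rule skew_brace_nat_copy[OF skew_brace_brace])
  show "perfect (nat_copy brace)" by (rule perfect_nat_copy[OF skew_brace_brace perfect_brace])
  \<comment> \<open>the exchange of the last two coordinates moves \<open>?z\<close>, but only by \<open>(0, 1, 1)\<close>\<close>
  let ?z = "(1, 0, (0, 1, 0)) :: elt"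
  show "Ann (brace_quotient (nat_copy brace) (Ann (nat_copy brace)))
    \<noteq> {\<one>\<^bsub>brace_quotient (nat_copy brace) (Ann (nat_copy brace))\<^esub>}"
  proof (rule nat_copy_second_annihilator[OF skew_brace_brace, where z = ?z])
    show "?z \<in> carrier brace" by (simp add: brace_simps)
    show "?z \<notin> Ann brace"
    proof
      assume "?z \<in> Ann brace"
      then have "(1, 0, (1, 0, 0)) \<odot>\<^bsub>brace\<^esub> ?z = ?z \<otimes>\<^bsub>brace\<^esub> (1, 0, (1, 0, 0))"
        by (rule brace.AnnD) (simp add: brace_simps)
      then show False
        by (simp add: brace_simps lam_value twist_def)
    qed
    fix x :: elt assume x: "x \<in> carrier brace"
    have one: "\<exists>c\<in>Ann brace. y = c \<otimes>\<^bsub>brace\<^esub> y" if "y \<in> carrier brace" for y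
      using Ann_diagonal[of 0] brace.l_one[OF that] unfolding brace_simps(3)
      by (metis zero_prod_def)
    show "\<exists>c\<in>Ann brace. ?z \<odot>\<^bsub>brace\<^esub> x = c \<otimes>\<^bsub>brace\<^esub> (?z \<otimes>\<^bsub>brace\<^esub> x)"
      using one x \<open>?z \<in> carrier brace\<close> by (simp add: brace_simps(4) lam_kernel)
    show "\<exists>c\<in>Ann brace. x \<otimes>\<^bsub>brace\<^esub> ?z = c \<otimes>\<^bsub>brace\<^esub> (?z \<otimes>\<^bsub>brace\<^esub> x)"
      using one x \<open>?z \<in> carrier brace\<close> by (simp flip: value_central)
    obtain t u p q r where "x = (t, u, (p, q, r))" by (rule prod_cases5)
    then have "x \<odot>\<^bsub>brace\<^esub> ?z = (1, 0, (0, twist x, twist x)) \<otimes>\<^bsub>brace\<^esub> (?z \<otimes>\<^bsub>brace\<^esub> x)"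
      by (cases "twist x") (simp_all add: brace_simps lam_value ac_simps)
    then show "\<exists>c\<in>Ann brace. x \<odot>\<^bsub>brace\<^esub> ?z = c \<otimes>\<^bsub>brace\<^esub> (?z \<otimes>\<^bsub>brace\<^esub> x)"
      using Ann_diagonal by blast
  qed
qed

end
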